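(* Let $a,b:[0,\infty)\to\mathbb{R}$ be positive continuous functions and let $x_0>0$. The initial-value problem $$\frac{dy(t)}{dt}=a(t)\,b(y(t)),\quad t>0,\qquad y(0)=x_0,$$ has a unique solution, given by $y(t)=B^{-1}(A(t))$ for $t<A^{-1}(B(\infty))$. The solution explodes in finite time if and only if $B(\infty)<A(\infty)$, in which case its time of explosion is $T_e^y=A^{-1}(B(\infty))$.
   Context: $A:[0,\infty)\to\mathbb{R}$ is $A(t)=\int_0^t a(s)\,ds$ and $B:[x_0,\infty)\to\mathbb{R}$ is $B(x)=\int_{x_0}^x \frac{ds}{b(s)}$; both are continuous and strictly increasing, and $A(\infty)$, $B(\infty)$ denote their limits in $(0,\infty]$ as the argument tends to $\infty$. Convention: $A^{-1}(s)=\infty$ if $s\ge A(\infty)$. The solution $y$ is taken on its maximal interval of existence and assigned the value $\infty$ from the moment it becomes infinite; its time of explosion is $T_e^y=\sup\{t\ge 0: y(t)<\infty\}\in[0,\infty]$, and $y$ explodes in finite time if $T_e^y<\infty$. *)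

theory Defs
  imports "HOL-Analysis.Analysis"
begin

definition A_int :: "(real \<Rightarrow> real) \<Rightarrow> real \<Rightarrow> real" where
  "A_int a t = integral {0..t} a"

definition B_int :: "(real \<Rightarrow> real) \<Rightarrow> real \<Rightarrow> real \<Rightarrow> real" where
  "B_int b x0 x = integral {x0..x} (\<lambda>s. 1 / b s)"

definition A_infty :: "(real \<Rightarrow> real) \<Rightarrow> ereal" where
  "A_infty a = Lim at_top (\<lambda>t. ereal (A_int a t))"

definition B_infty :: "(real \<Rightarrow> real) \<Rightarrow> real \<Rightarrow> ereal" where
  "B_infty b x0 = Lim at_top (\<lambda>x. ereal (B_int b x0 x))"

(* Meant for arguments s \<ge> 0, possibly infinite. *)
definition A_inv :: "(real \<Rightarrow> real) \<Rightarrow> ereal \<Rightarrow> ereal" where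
  "A_inv a s = (if s \<ge> A_infty a then \<infinity>
                else ereal (the_inv_into {0..} (A_int a) (real_of_ereal s)))"

definition B_inv :: "(real \<Rightarrow> real) \<Rightarrow> real \<Rightarrow> real \<Rightarrow> real" where
  "B_inv b x0 s = the_inv_into {x0..} (B_int b x0) s"

(* J is any nondegenerate interval with left endpoint 0 (included), bounded or not.
   The derivative is two-sided at interior points and one-sided at a right endpoint
   belonging to J.  The requirement u t \<ge> 0 keeps u inside the domain of b. *)
definition solves_ivp_on ::
  "(real \<Rightarrow> real) \<Rightarrow> (real \<Rightarrow> real) \<Rightarrow> real \<Rightarrow> real set \<Rightarrow> (real \<Rightarrow> real) \<Rightarrow> bool" where
  "solves_ivp_on a b x0 J u \<longleftrightarrow>
     is_interval J \<and> J \<subseteq> {0..} \<and> 0 \<in> J \<and> (\<exists>t\<in>J. 0 < t) \<and>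
     u 0 = x0 \<and> continuous_on J u \<and> (\<forall>t\<in>J. 0 \<le> u t) \<and>
     (\<forall>t\<in>J. 0 < t \<longrightarrow> (u has_real_derivative a t * b (u t)) (at t within J))"

definition maximal_solution ::
  "(real \<Rightarrow> real) \<Rightarrow> (real \<Rightarrow> real) \<Rightarrow> real \<Rightarrow> real set \<Rightarrow> (real \<Rightarrow> real) \<Rightarrow> bool" where
  "maximal_solution a b x0 J u \<longleftrightarrow>
     solves_ivp_on a b x0 J u \<and>
     \<not> (\<exists>K v. J \<subset> K \<and> solves_ivp_on a b x0 K v \<and> (\<forall>t\<in>J. v t = u t))"

(* y is a maximal solution u, given the value \<infinity> after the end of its interval J of existence
   provided that u becomes infinite there.  If u stopped at the end of J without becoming
   infinite, the values of y beyond J would be left open, so that uniqueness of y on [0,\<infinity>)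
   includes the fact that this never happens.  Values at negative times are irrelevant. *)
definition is_solution ::
  "(real \<Rightarrow> real) \<Rightarrow> (real \<Rightarrow> real) \<Rightarrow> real \<Rightarrow> (real \<Rightarrow> ereal) \<Rightarrow> bool" where
  "is_solution a b x0 y \<longleftrightarrow>
     (\<exists>J u. maximal_solution a b x0 J u \<and>
        (\<forall>t\<in>J. y t = ereal (u t)) \<and>
        (filterlim u at_top (at_left (Sup J)) \<longrightarrow> (\<forall>t\<ge>0. t \<notin> J \<longrightarrow> y t = \<infinity>)))"

definition explosion_time :: "(real \<Rightarrow> ereal) \<Rightarrow> ereal" where
  "explosion_time y = Sup {ereal t | t. 0 \<le> t \<and> y t < \<infinity>}"

definition explodes :: "(real \<Rightarrow> ereal) \<Rightarrow> bool" where
  "explodes y \<longleftrightarrow> explosion_time y < \<infinity>"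

end

theory Submission imports Defs begin

text \<open>
  Along a solution \<open>u\<close> the function \<open>B \<circ> u - A\<close> has derivative \<open>0\<close> and vanishes at \<open>0\<close>, so
  \<open>B (u t) = A t\<close>. As \<open>B\<close> only takes values below \<open>B(\<infinity>)\<close>, every solution is a
  restriction of \<open>B\<inverse> \<circ> A\<close> to a subinterval of \<open>{t \<ge> 0. A t < B(\<infinity>)}\<close>, and on that whole
  interval \<open>B\<inverse> \<circ> A\<close> is a solution by the inverse function rule.
\<close>

section \<open>Primitives of positive continuous functions on a half-line, and their inverses (used
  for both \<open>A\<close> and \<open>B\<close>)\<close>

locale positive_integrand =
  fixes f :: "real \<Rightarrow> real" and c :: real
  assumes cont: "continuous_on {c..} f" and pos: "\<And>x. c \<le> x \<Longrightarrow> 0 < f x"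
begin

definition primitive :: "real \<Rightarrow> real" where
  "primitive x = integral {c..x} f"

definition total_integral :: ereal where
  "total_integral = Lim at_top (\<lambda>x. ereal (primitive x))"

definition inverse_primitive :: "real \<Rightarrow> real" where
  "inverse_primitive = the_inv_into {c..} primitive"

lemma primitive_base [simp]: "primitive c = 0"
  by (simp add: primitive_def)

lemma primitive_deriv_within:
  assumes "c \<le> x"
  shows "(primitive has_real_derivative f x) (at x within {c..})"
proof -
  \<comment> \<open>The endpoint \<open>x + 1\<close> leaves room to the right of \<open>x\<close>,
    so that near \<open>x\<close> the compact interval coincides with the half-line.\<close>
  have "continuous_on {c..x + 1} f"
    by (rule continuous_on_subset [OF cont]) auto
  then have "((\<lambda>x. integral {c..x} f) has_real_derivative f x) (at x within {c..x + 1})"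
    by (rule integral_has_real_derivative) (use assms in auto)
  moreover have "at x within {c..x + 1} = at x within {c..}"
    by (rule at_within_nhd [of x "{..<x + 1}"]) auto
  ultimately show ?thesis
    by (simp add: primitive_def [abs_def])
qed

lemma primitive_deriv:
  assumes "c < x"
  shows "(primitive has_real_derivative f x) (at x)"
proof -
  have "at x within {c..} = at x"
    by (rule at_within_interior) (use assms in \<open>auto simp: interior_Ici [of "c - 1"]\<close>)
  then show ?thesis
    using primitive_deriv_within [of x] assms by simp
qed

lemma primitive_continuous_on: "continuous_on {c..} primitive"
  by (rule DERIV_continuous_on) (use primitive_deriv_within in auto)

lemma primitive_less:
  assumes "c \<le> x" "x < y"
  shows "primitive x < primitive y"
proof (rule DERIV_pos_imp_increasing_open [OF \<open>x < y\<close>])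
  show "continuous_on {x..y} primitive"
    by (rule continuous_on_subset [OF primitive_continuous_on]) (use assms in auto)
  show "\<exists>d. DERIV primitive z :> d \<and> 0 < d" if "x < z" for z
    using primitive_deriv [of z] pos [of z] that assms by auto
qed

lemma primitive_less_iff:
  assumes "c \<le> x" "c \<le> y"
  shows "primitive x < primitive y \<longleftrightarrow> x < y"
  using primitive_less [of x y] primitive_less [of y x] assms
  by (cases x y rule: linorder_cases) auto

lemma primitive_le_iff:
  assumes "c \<le> x" "c \<le> y"
  shows "primitive x \<le> primitive y \<longleftrightarrow> x \<le> y"
  using primitive_less_iff [OF assms(2,1)] by linarith

lemma primitive_inj: "inj_on primitive {c..}"
  by (rule inj_onI) (simp add: order_eq_iff primitive_le_iff)

lemma primitive_nonneg: "c \<le> x \<Longrightarrow> 0 \<le> primitive x"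
  using primitive_less [of c x] by (cases "x = c") auto

text \<open>An increasing function tends to its supremum, so the definite description
  \<open>Lim\<close> really denotes a limit here. The supremum form reduces strict lower bounds on
  the total integral to the value of the primitive at a single point.\<close>

lemma total_integral_eq_SUP: "total_integral = (SUP x\<in>{c..}. ereal (primitive x))"
proof -
  have "((\<lambda>x. ereal (primitive x)) \<longlongrightarrow> (SUP x\<in>{c..}. ereal (primitive x))) at_top"
  proof (rule order_tendstoI)
    fix l assume "l < (SUP x\<in>{c..}. ereal (primitive x))"
    then obtain x where x: "c \<le> x" "l < ereal (primitive x)"
      by (auto simp: less_SUP_iff)
    have "l < ereal (primitive y)" if "x \<le> y" for y
    proof -
      have "primitive x \<le> primitive y"
        using primitive_less [of x y] x that by (cases "x = y") auto
      then show ?thesis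
        using x(2) by (meson ereal_less_eq(3) less_le_trans)
    qed
    then show "\<forall>\<^sub>F x in at_top. l < ereal (primitive x)"
      using eventually_at_top_linorder by blast
  next
    fix l assume l: "(SUP x\<in>{c..}. ereal (primitive x)) < l"
    have "ereal (primitive x) < l" if "c \<le> x" for x
      by (rule le_less_trans [OF SUP_upper l]) (use that in auto)
    then show "\<forall>\<^sub>F x in at_top. ereal (primitive x) < l"
      using eventually_at_top_linorder by blast
  qed
  then show ?thesis
    unfolding total_integral_def by (intro tendsto_Lim) auto
qed

lemma less_total_integral_iff: "l < total_integral \<longleftrightarrow> (\<exists>x\<ge>c. l < ereal (primitive x))"
  by (auto simp: total_integral_eq_SUP less_SUP_iff)

text \<open>The primitive still grows between \<open>x\<close> and \<open>x + 1\<close>, so even a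
  finite limit is never attained. This strictness is what confines solutions to
  \<open>domain\<close> later.\<close>

lemma primitive_less_total_integral: "c \<le> x \<Longrightarrow> ereal (primitive x) < total_integral"
  using primitive_less [of x "x + 1"] by (auto simp: less_total_integral_iff intro!: exI [of _ "x + 1"])

lemma total_integral_pos: "0 < total_integral"
  using primitive_less_total_integral [of c] by (simp add: zero_ereal_def)

lemma primitive_image_Icc:
  assumes "c \<le> x"
  shows "primitive ` {c..x} = {0..primitive x}"
proof
  show "primitive ` {c..x} \<subseteq> {0..primitive x}"
    using assms by (auto simp: primitive_nonneg primitive_le_iff)
  show "{0..primitive x} \<subseteq> primitive ` {c..x}"
  proof
    fix s assume "s \<in> {0..primitive x}"
    moreover have "continuous_on {c..x} primitive"
      by (rule continuous_on_subset [OF primitive_continuous_on]) auto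
    ultimately show "s \<in> primitive ` {c..x}"
      using IVT' [of primitive c s x] assms by auto
  qed
qed

lemma inverse_primitive_primitive [simp]: "c \<le> x \<Longrightarrow> inverse_primitive (primitive x) = x"
  unfolding inverse_primitive_def by (rule the_inv_into_f_f [OF primitive_inj]) auto

lemma
  assumes "0 \<le> s" "ereal s < total_integral"
  shows inverse_primitive_ge: "c \<le> inverse_primitive s"
    and primitive_inverse_primitive [simp]: "primitive (inverse_primitive s) = s"
proof -
  obtain x where "c \<le> x" "s < primitive x"
    using assms by (auto simp: less_total_integral_iff)
  then have "s \<in> primitive ` {c..x}"
    using assms by (simp add: primitive_image_Icc)
  then show "c \<le> inverse_primitive s" "primitive (inverse_primitive s) = s"
    by auto
qed

text \<open>Continuity is local, and the inverse of a continuous injection on a compact set is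
  continuous. For given \<open>s\<close> the compact interval \<open>{c..x}\<close> with
  \<open>s < primitive x\<close> is enough, because its image agrees near \<open>s\<close> with the
  whole range.\<close>

lemma inverse_primitive_continuous_on:
  "continuous_on {s. 0 \<le> s \<and> ereal s < total_integral} inverse_primitive"
  unfolding continuous_on_eq_continuous_within
proof
  fix s assume s: "s \<in> {s. 0 \<le> s \<and> ereal s < total_integral}"
  then obtain x where x: "c \<le> x" "s < primitive x"
    by (auto simp: less_total_integral_iff)
  have "continuous_on (primitive ` {c..x}) inverse_primitive"
  proof (rule continuous_on_inv)
    show "continuous_on {c..x} primitive"
      by (rule continuous_on_subset [OF primitive_continuous_on]) auto
  qed auto
  then have "continuous (at s within {0..primitive x}) inverse_primitive"
    using s x by (simp add: primitive_image_Icc continuous_on_eq_continuous_within)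
  moreover have "at s within {0..primitive x} = at s within {s. 0 \<le> s \<and> ereal s < total_integral}"
  proof (rule at_within_nhd [of s "{..<primitive x}"])
    have "ereal r < total_integral" if "r \<le> primitive x" for r
      by (rule le_less_trans [OF _ primitive_less_total_integral [OF x(1)]]) (use that in simp)
    then show "{0..primitive x} \<inter> {..<primitive x} - {s} =
        {s. 0 \<le> s \<and> ereal s < total_integral} \<inter> {..<primitive x} - {s}"
      by auto
  qed (use x in auto)
  ultimately show "continuous (at s within {s. 0 \<le> s \<and> ereal s < total_integral}) inverse_primitive"
    by simp
qed

text \<open>For \<open>0 < s\<close> the point \<open>inverse_primitive s\<close> lies strictly to
  the right of \<open>c\<close>, where the primitive has a two-sided derivative. The inverse
  function rule then applies on the open interval from 0 to \<open>primitive x\<close>, for any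
  \<open>x\<close> with \<open>s < primitive x\<close>.\<close>

lemma inverse_primitive_deriv:
  assumes "0 < s" "ereal s < total_integral"
  shows "(inverse_primitive has_real_derivative inverse (f (inverse_primitive s))) (at s)"
proof -
  obtain x where x: "c \<le> x" "s < primitive x"
    using assms by (auto simp: less_total_integral_iff)
  have below: "ereal r < total_integral" if "r < primitive x" for r
    by (rule less_trans [OF _ primitive_less_total_integral [OF x(1)]]) (use that in simp)
  have ge: "c \<le> inverse_primitive s"
    using assms by (simp add: inverse_primitive_ge)
  moreover have "inverse_primitive s \<noteq> c"
    using primitive_inverse_primitive [of s] assms
    by (metis less_imp_le less_irrefl primitive_base)
  ultimately have gt: "c < inverse_primitive s"
    by simp
  show ?thesis
  proof (rule DERIV_inverse_function [where f = primitive and a = 0 and b = "primitive x"])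
    show "DERIV primitive (inverse_primitive s) :> f (inverse_primitive s)"
      using gt by (rule primitive_deriv)
    show "f (inverse_primitive s) \<noteq> 0"
      using pos [OF ge] by simp
    have "continuous_on {0<..<primitive x} inverse_primitive"
      by (rule continuous_on_subset [OF inverse_primitive_continuous_on]) (auto simp: below)
    then show "isCont inverse_primitive s"
      using assms x by (simp add: continuous_on_eq_continuous_at)
  qed (use assms x below in auto)
qed

end

section \<open>The initial-value problem and its candidate solution\<close>

locale separable_ivp =
  fixes a b :: "real \<Rightarrow> real" and x0 :: real
  assumes a_cont: "continuous_on {0..} a" and a_pos: "\<And>t. 0 \<le> t \<Longrightarrow> 0 < a t"
    and b_cont: "continuous_on {0..} b" and b_pos: "\<And>x. 0 \<le> x \<Longrightarrow> 0 < b x"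
    and x0_pos: "0 < x0"
begin

sublocale A: positive_integrand a 0
  by unfold_locales (fact a_cont, fact a_pos)

sublocale B: positive_integrand "\<lambda>s. 1 / b s" x0
proof
  have b_pos': "0 < b x" if "x0 \<le> x" for x
    using that x0_pos b_pos [of x] by simp
  then show "0 < 1 / b x" if "x0 \<le> x" for x
    using that by simp
  have "continuous_on {x0..} b"
    by (rule continuous_on_subset [OF b_cont]) (use x0_pos in auto)
  then show "continuous_on {x0..} (\<lambda>s. 1 / b s)"
    by (rule continuous_on_divide [OF continuous_on_const]) (use b_pos' in fastforce)
qed

lemma A_int_eq: "A_int a = A.primitive"
  by (simp add: fun_eq_iff A_int_def A.primitive_def)

lemma B_int_eq: "B_int b x0 = B.primitive"
  by (simp add: fun_eq_iff B_int_def B.primitive_def)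

lemma A_infty_eq: "A_infty a = A.total_integral"
  by (simp add: A_infty_def A.total_integral_def A_int_eq)

lemma B_infty_eq: "B_infty b x0 = B.total_integral"
  by (simp add: B_infty_def B.total_integral_def B_int_eq)

lemma B_inv_eq: "B_inv b x0 = B.inverse_primitive"
  by (simp add: fun_eq_iff B_inv_def B.inverse_primitive_def B_int_eq)

lemma A_inv_eq:
  "A_inv a s = (if s \<ge> A.total_integral then \<infinity> else ereal (A.inverse_primitive (real_of_ereal s)))"
  by (simp add: A_inv_def A.inverse_primitive_def A_int_eq A_infty_eq)

text \<open>This is the half-open interval from 0 to the explosion time. Comparing values of
  \<open>A\<close> with the limit of \<open>B\<close>, instead of using \<open>A_inv\<close>, covers
  the explosive and the global case at once.\<close>

definition domain :: "real set" where
  "domain = {t. 0 \<le> t \<and> ereal (A.primitive t) < B.total_integral}"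

definition sol :: "real \<Rightarrow> real" where
  "sol t = B.inverse_primitive (A.primitive t)"

section \<open>Uniqueness on any interval of existence\<close>

lemma solution_unique:
  assumes sol: "solves_ivp_on a b x0 J u" and t: "t \<in> J"
  shows "t \<in> domain" "u t = sol t"
proof -
  have J: "J \<subseteq> {0..}" "0 \<in> J" "is_interval J" and u0: "u 0 = x0"
    and cont: "continuous_on J u" and nonneg: "\<And>t. t \<in> J \<Longrightarrow> 0 \<le> u t"
    and deriv: "\<And>t. t \<in> J \<Longrightarrow> 0 < t \<Longrightarrow>
      (u has_real_derivative a t * b (u t)) (at t within J)"
    using sol unfolding solves_ivp_on_def by blast+
  have sub: "{0..s} \<subseteq> J" if "s \<in> J" for s
    by (rule subsetI, rule mem_is_interval_1_I [OF J(3,2) that]) auto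
  \<comment> \<open>Strictly between 0 and another point of \<open>J\<close> the derivative within
    \<open>J\<close> is two-sided, as the monotonicity and constancy arguments below
    require.\<close>
  have deriv_at: "DERIV u r :> a r * b (u r)" if "0 < r" "r < s" "s \<in> J" for r s
  proof -
    have "at r within J = at r"
    proof (rule at_within_interior)
      have "{0<..<s} \<subseteq> interior J"
        using sub [OF that(3)] by (intro interior_maximal) auto
      then show "r \<in> interior J"
        using that by auto
    qed
    moreover have "r \<in> J"
      using sub [OF that(3)] that by (simp add: subset_iff)
    ultimately show ?thesis
      using deriv [of r] that by simp
  qed
  \<comment> \<open>Since \<open>u\<close> is nonnegative, its derivative is positive. Hence
    \<open>u\<close> moves strictly above \<open>x0\<close>, where \<open>B\<close> has a two-sided
    derivative and the chain rule is available.\<close>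
  have gt: "x0 < u s" if "s \<in> J" "0 < s" for s
  proof -
    have "u 0 < u s"
    proof (rule DERIV_pos_imp_increasing_open [OF that(2)])
      show "continuous_on {0..s} u"
        by (rule continuous_on_subset [OF cont sub [OF that(1)]])
      fix r assume r: "0 < r" "r < s"
      then have "r \<in> J"
        using sub [OF that(1)] by auto
      then show "\<exists>d. DERIV u r :> d \<and> 0 < d"
        using deriv_at [OF r that(1)] a_pos [of r] b_pos nonneg r by force
    qed
    then show ?thesis
      by (simp add: u0)
  qed
  have ge: "x0 \<le> u s" if "s \<in> J" for s
    using gt [OF that] u0 J that by (cases "s = 0") (auto simp: subset_iff order_le_less)
  have eq: "B.primitive (u t) = A.primitive t"
  proof (cases "t = 0")
    case True
    then show ?thesis by (simp add: u0)
  next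
    case False
    then have "0 < t"
      using t J by auto
    have "B.primitive (u t) - A.primitive t = B.primitive (u 0) - A.primitive 0"
    proof (rule DERIV_isconst2 [OF \<open>0 < t\<close>, where f = "\<lambda>s. B.primitive (u s) - A.primitive s"])
      have "continuous_on {0..t} (B.primitive \<circ> u)"
      proof (rule continuous_on_compose)
        show "continuous_on {0..t} u"
          by (rule continuous_on_subset [OF cont sub [OF t]])
        show "continuous_on (u ` {0..t}) B.primitive"
          by (rule continuous_on_subset [OF B.primitive_continuous_on]) (use ge sub [OF t] in auto)
      qed
      moreover have "continuous_on {0..t} A.primitive"
        by (rule continuous_on_subset [OF A.primitive_continuous_on]) auto
      ultimately show "continuous_on {0..t} (\<lambda>s. B.primitive (u s) - A.primitive s)"
        by (simp add: o_def continuous_on_diff)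
      fix r assume r: "0 < r" "r < t"
      then have rJ: "r \<in> J"
        using sub [OF t] by auto
      have "DERIV (\<lambda>s. B.primitive (u s)) r :> 1 / b (u r) * (a r * b (u r))"
        using B.primitive_deriv [OF gt [OF rJ r(1)]] deriv_at [OF r t] by (rule DERIV_chain2)
      then have "DERIV (\<lambda>s. B.primitive (u s) - A.primitive s) r :>
          1 / b (u r) * (a r * b (u r)) - a r"
        by (intro DERIV_diff A.primitive_deriv r)
      then show "DERIV (\<lambda>s. B.primitive (u s) - A.primitive s) r :> 0"
        using b_pos [OF nonneg [OF rJ]] by simp
    qed (use \<open>0 < t\<close> in auto)
    then show ?thesis
      by (simp add: u0)
  qed
  show "t \<in> domain"
    using B.primitive_less_total_integral [OF ge [OF t]] t J by (auto simp: domain_def eq)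
  show "u t = sol t"
    using B.inverse_primitive_primitive [OF ge [OF t]] by (simp add: sol_def eq)
qed

section \<open>Existence and maximality of the solution on \<open>domain\<close>\<close>

lemma domain_downward:
  assumes "t \<in> domain" "0 \<le> s" "s \<le> t"
  shows "s \<in> domain"
proof -
  have "A.primitive s \<le> A.primitive t"
    using assms by (simp add: A.primitive_le_iff)
  then have "ereal (A.primitive s) \<le> ereal (A.primitive t)"
    by simp
  then show ?thesis
    using assms unfolding domain_def by (blast intro: le_less_trans)
qed

text \<open>In the explosive case \<open>domain\<close> ends at the point \<open>T\<close> where
  \<open>A\<close> reaches the finite limit of \<open>B\<close>, and the midpoint of
  \<open>t\<close> and \<open>T\<close> serves. Otherwise \<open>A\<close> stays below that limit
  forever, and \<open>t + 1\<close> serves. Applied at 0, this shows that \<open>domain\<close> is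
  nondegenerate.\<close>

lemma domain_extends:
  assumes "t \<in> domain"
  obtains s where "t < s" "s \<in> domain"
proof (cases "B.total_integral < A.total_integral")
  case True
  then obtain r where r: "B.total_integral = ereal r" "0 < r"
    using B.total_integral_pos by (cases B.total_integral) auto
  define T where "T = A.inverse_primitive r"
  have T: "0 \<le> T" "A.primitive T = r"
    using A.inverse_primitive_ge [of r] A.primitive_inverse_primitive [of r] r True
    by (auto simp: T_def)
  have "t < T"
    using assms r T A.primitive_less_iff [of t T] by (auto simp: domain_def)
  then have mid: "t < (t + T) / 2" "(t + T) / 2 < T" "0 \<le> (t + T) / 2"
    using assms by (auto simp: domain_def)
  show ?thesis
  proof (rule that [OF mid(1)])
    show "(t + T) / 2 \<in> domain"
      using mid T r A.primitive_less [of "(t + T) / 2" T] by (auto simp: domain_def)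
  qed
next
  case False
  show ?thesis
  proof (rule that [of "t + 1"])
    have "ereal (A.primitive (t + 1)) < A.total_integral"
      using assms by (intro A.primitive_less_total_integral) (auto simp: domain_def)
    then show "t + 1 \<in> domain"
      using False assms by (auto simp: domain_def)
  qed simp
qed

lemma zero_in_domain: "0 \<in> domain"
  using B.total_integral_pos by (simp add: domain_def zero_ereal_def)

lemma sol_ge: "t \<in> domain \<Longrightarrow> x0 \<le> sol t"
  unfolding sol_def domain_def by (intro B.inverse_primitive_ge) (auto simp: A.primitive_nonneg)

lemma sol_solves: "solves_ivp_on a b x0 domain sol"
  unfolding solves_ivp_on_def
proof (intro conjI ballI impI)
  show "is_interval domain"
    unfolding is_interval_1 using domain_downward by (force simp: domain_def)
  show "domain \<subseteq> {0..}"
    by (auto simp: domain_def)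
  show "\<exists>t\<in>domain. 0 < t"
    using domain_extends [OF zero_in_domain] by blast
  show "sol 0 = x0"
    using B.inverse_primitive_primitive [of x0] by (simp add: sol_def)
  show "0 \<le> sol t" if "t \<in> domain" for t
    using sol_ge [OF that] x0_pos by simp
  have "continuous_on domain (B.inverse_primitive \<circ> A.primitive)"
  proof (rule continuous_on_compose)
    show "continuous_on domain A.primitive"
      by (rule continuous_on_subset [OF A.primitive_continuous_on]) (auto simp: domain_def)
    show "continuous_on (A.primitive ` domain) B.inverse_primitive"
      by (rule continuous_on_subset [OF B.inverse_primitive_continuous_on])
        (auto simp: domain_def A.primitive_nonneg)
  qed
  then show "continuous_on domain sol"
    by (simp add: sol_def [abs_def] o_def)
  fix t assume t: "t \<in> domain" "0 < t"
  \<comment> \<open>The inverse function rule turns the integrand \<open>1 / b\<close> of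
    \<open>B\<close> back into \<open>b\<close>. It is applicable because \<open>t > 0\<close> makes
    \<open>A.primitive t\<close> positive.\<close>
  have "DERIV B.inverse_primitive (A.primitive t) :> inverse (1 / b (sol t))"
    using B.inverse_primitive_deriv [of "A.primitive t"] A.primitive_less [of 0 t] t
    by (simp add: domain_def sol_def)
  then have "DERIV sol t :> inverse (1 / b (sol t)) * a t"
    unfolding sol_def [abs_def] using A.primitive_deriv [OF t(2)] by (rule DERIV_chain2)
  then show "(sol has_real_derivative a t * b (sol t)) (at t within domain)"
    by (simp add: mult.commute has_field_derivative_at_within)
qed (fact zero_in_domain)

text \<open>By uniqueness every solution is a restriction of \<open>sol\<close> to a part of
  \<open>domain\<close>: one on a smaller interval is extended by \<open>sol\<close>, and none
  reaches beyond \<open>domain\<close>. The values of \<open>u\<close> outside \<open>domain\<close>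
  are arbitrary, so agreement is claimed only there.\<close>

lemma maximal_solution_iff:
  "maximal_solution a b x0 J u \<longleftrightarrow> J = domain \<and> (\<forall>t\<in>domain. u t = sol t)"
proof
  assume max: "maximal_solution a b x0 J u"
  then have sol: "solves_ivp_on a b x0 J u"
    by (simp add: maximal_solution_def)
  have "J \<subseteq> domain" and eq: "\<forall>t\<in>J. u t = sol t"
    using solution_unique [OF sol] by auto
  moreover have "\<not> J \<subset> domain"
    using max sol_solves eq unfolding maximal_solution_def by metis
  ultimately show "J = domain \<and> (\<forall>t\<in>domain. u t = sol t)"
    by blast
next
  assume eq: "J = domain \<and> (\<forall>t\<in>domain. u t = sol t)"
  then have u: "u t = sol t" if "t \<in> domain" for t
    using that by simp
  have "solves_ivp_on a b x0 domain u"
    unfolding solves_ivp_on_def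
  proof (intro conjI ballI impI)
    show "continuous_on domain u"
      using sol_solves u by (simp add: solves_ivp_on_def cong: continuous_on_cong)
    fix t assume t: "t \<in> domain" "0 < t"
    then have "(sol has_real_derivative a t * b (u t)) (at t within domain)"
      using sol_solves u by (simp add: solves_ivp_on_def)
    \<comment> \<open>Any positive radius would do, since \<open>u\<close> and \<open>sol\<close>
      agree on all of \<open>domain\<close>.\<close>
    then show "(u has_real_derivative a t * b (u t)) (at t within domain)"
      by (rule has_field_derivative_transform_within [OF _ zero_less_one]) (use t u in auto)
  qed (use sol_solves u in \<open>auto simp: solves_ivp_on_def\<close>)
  moreover have "\<not> domain \<subset> K" if "solves_ivp_on a b x0 K v" for K v
    using solution_unique(1) [OF that] by blast
  ultimately show "maximal_solution a b x0 J u"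
    using eq by (auto simp: maximal_solution_def)
qed

section \<open>The end of \<open>domain\<close> and the blow-up there\<close>

lemma domain_if_not_explosive:
  assumes "\<not> B.total_integral < A.total_integral"
  shows "domain = {0..}"
  using assms A.primitive_less_total_integral by (fastforce simp: domain_def)

text \<open>The limit of \<open>B\<close> is finite here, and \<open>A\<close> attains it at exactly
  one time \<open>T\<close>. As \<open>t\<close> tends to \<open>T\<close> from the left,
  \<open>A t\<close> exceeds \<open>B x\<close> for each fixed \<open>x\<close>, since
  \<open>B x\<close> lies strictly below that limit; then \<open>sol t\<close> exceeds
  \<open>x\<close>.\<close>

lemma
  assumes "B.total_integral < A.total_integral"
  shows blow_up_eq: "A_inv a B.total_integral = ereal (Sup domain)"
    and domain_if_explosive: "domain = {0..<Sup domain}"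
    and sol_blows_up: "filterlim sol at_top (at_left (Sup domain))"
proof -
  obtain r where r: "B.total_integral = ereal r" "0 < r"
    using assms B.total_integral_pos by (cases B.total_integral) auto
  define T where "T = A.inverse_primitive r"
  have T: "0 \<le> T" "A.primitive T = r"
    using A.inverse_primitive_ge [of r] A.primitive_inverse_primitive [of r] r assms
    by (auto simp: T_def)
  have dom: "domain = {0..<T}"
    using A.primitive_less_iff [of _ T] T r by (auto simp: domain_def)
  then have "0 < T"
    using zero_in_domain by auto
  then have Sup: "Sup domain = T"
    by (simp add: dom)
  show "domain = {0..<Sup domain}"
    by (subst Sup) (fact dom)
  show "A_inv a B.total_integral = ereal (Sup domain)"
    using assms by (simp add: A_inv_eq Sup r(1) T_def leD)
  show "filterlim sol at_top (at_left (Sup domain))"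
    unfolding filterlim_at_top Sup
  proof
    fix Z
    \<comment> \<open>The level \<open>Z\<close> is raised to at least \<open>x0\<close>, because
      \<open>B\<close> is increasing only from there on.\<close>
    define x where "x = max x0 Z"
    have x: "x0 \<le> x" "Z \<le> x"
      by (auto simp: x_def)
    have lt: "B.primitive x < A.primitive T"
      using B.primitive_less_total_integral [OF x(1)] r T by simp
    have "(A.primitive \<longlongrightarrow> A.primitive T) (at_left T)"
      using DERIV_isCont [OF A.primitive_deriv [OF \<open>0 < T\<close>]]
      by (auto simp: isCont_def intro: filterlim_mono [OF _ order_refl at_le])
    then have "\<forall>\<^sub>F t in at_left T. B.primitive x < A.primitive t"
      using lt by (rule order_tendstoD)
    moreover have "\<forall>\<^sub>F t in at_left T. t \<in> {0<..<T}"
      using \<open>0 < T\<close> by (rule eventually_at_left_real)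
    ultimately show "\<forall>\<^sub>F t in at_left T. Z \<le> sol t"
    proof eventually_elim
      case (elim t)
      then have t: "t \<in> domain"
        by (simp add: dom)
      then have "B.primitive (sol t) = A.primitive t"
        unfolding sol_def by (intro B.primitive_inverse_primitive)
          (auto simp: domain_def A.primitive_nonneg)
      then have "x < sol t"
        using elim B.primitive_less_iff [OF x(1) sol_ge [OF t]] by simp
      then show ?case
        using x by simp
    qed
  qed
qed

section \<open>The extended-valued solution and its time of explosion\<close>

definition extended_sol :: "real \<Rightarrow> ereal" where
  "extended_sol t = (if t \<in> domain then ereal (sol t) else \<infinity>)"

lemma is_solution_extended_sol: "is_solution a b x0 extended_sol"
  unfolding is_solution_def
  by (intro exI [of _ domain] exI [of _ sol]) (auto simp: maximal_solution_iff extended_sol_def)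

text \<open>Beyond \<open>domain\<close> the value \<infinity> is prescribed only if
  \<open>u\<close> blows up at the end. But a time \<open>t \<ge> 0\<close> outside
  \<open>domain\<close> exists only in the explosive case, where \<open>sol\<close> blows up, and so
  does \<open>u\<close>, which agrees with it on \<open>domain\<close>.\<close>

lemma is_solution_unique:
  assumes "is_solution a b x0 z" "0 \<le> t"
  shows "z t = extended_sol t"
proof -
  obtain u where u: "\<forall>t\<in>domain. u t = sol t" "\<forall>t\<in>domain. z t = ereal (u t)"
    and ext: "filterlim u at_top (at_left (Sup domain)) \<longrightarrow> (\<forall>t\<ge>0. t \<notin> domain \<longrightarrow> z t = \<infinity>)"
    using assms(1) unfolding is_solution_def maximal_solution_iff by auto
  show ?thesis
  proof (cases "t \<in> domain")
    case True
    then show ?thesis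
      using u by (simp add: extended_sol_def)
  next
    case False
    then have expl: "B.total_integral < A.total_integral"
      using domain_if_not_explosive assms(2) by auto
    have "0 < Sup domain"
      using zero_in_domain domain_if_explosive [OF expl] by (metis atLeastLessThan_iff)
    then have "\<forall>\<^sub>F s in at_left (Sup domain). s \<in> {0<..<Sup domain}"
      by (rule eventually_at_left_real)
    then have "\<forall>\<^sub>F s in at_left (Sup domain). sol s = u s"
    proof eventually_elim
      case (elim s)
      then have "s \<in> domain"
        by (subst domain_if_explosive [OF expl]) auto
      then show ?case
        using u by simp
    qed
    then have "filterlim u at_top (at_left (Sup domain))"
      using sol_blows_up [OF expl] filterlim_cong by fast
    then show ?thesis
      using ext False assms(2) by (simp add: extended_sol_def)
  qed
qed

text \<open>The values are finite exactly on \<open>domain\<close>, so the explosion time is the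
  supremum of \<open>domain\<close>. In the global case this is \<infinity>, in accordance with the
  convention built into \<open>A_inv\<close>.\<close>

lemma explosion_time_extended_sol:
  "explosion_time extended_sol = A_inv a B.total_integral"
proof -
  have "{ereal t |t. 0 \<le> t \<and> extended_sol t < \<infinity>} = ereal ` domain"
    by (auto simp: extended_sol_def domain_def)
  then have eq: "explosion_time extended_sol = Sup (ereal ` domain)"
    by (simp add: explosion_time_def)
  show ?thesis
  proof (cases "B.total_integral < A.total_integral")
    case True
    have "Sup (ereal ` domain) \<le> ereal (Sup domain)"
    proof (rule SUP_least)
      fix t assume "t \<in> domain"
      then have "t < Sup domain"
        using domain_if_explosive [OF True] by (metis atLeastLessThan_iff)
      then show "ereal t \<le> ereal (Sup domain)"
        by simp
    qed
    \<comment> \<open>With bounds on both sides the supremum is a real number, so it commutes with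
      the embedding \<open>ereal\<close>.\<close>
    moreover have "ereal 0 \<le> Sup (ereal ` domain)"
      by (rule SUP_upper [OF zero_in_domain])
    ultimately have "\<bar>Sup (ereal ` domain)\<bar> \<noteq> \<infinity>"
      by (cases "Sup (ereal ` domain)") auto
    then have "ereal (Sup domain) = Sup (ereal ` domain)"
      by (rule ereal_Sup)
    then show ?thesis
      by (simp add: eq blow_up_eq [OF True])
  next
    case False
    have "Sup (ereal ` {0..}) = \<infinity>"
    proof (rule SUP_PInfty)
      fix n :: nat show "\<exists>t\<in>{0..}. ereal (real n) \<le> ereal t"
        by (rule bexI [of _ "real n"]) auto
    qed
    then show ?thesis
      using False by (simp add: eq domain_if_not_explosive A_inv_eq)
  qed
qed

text \<open>Links the time bound of the theorem, phrased with \<open>A_inv\<close>, to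
  \<open>domain\<close>.\<close>

lemma in_domain_if_less_blow_up:
  assumes "0 \<le> t" "ereal t < A_inv a B.total_integral"
  shows "t \<in> domain"
proof (cases "B.total_integral < A.total_integral")
  case True
  then show ?thesis
    using assms by (subst domain_if_explosive) (auto simp: blow_up_eq)
qed (use assms in \<open>simp add: domain_if_not_explosive\<close>)

end

theorem lemma2:
  fixes a b :: "real \<Rightarrow> real" and x0 :: real
  assumes "continuous_on {0..} a" and "\<And>t. 0 \<le> t \<Longrightarrow> 0 < a t"
    and "continuous_on {0..} b" and "\<And>x. 0 \<le> x \<Longrightarrow> 0 < b x"
    and "0 < x0"
  shows "\<exists>y. is_solution a b x0 y \<and>
           (\<forall>z. is_solution a b x0 z \<longrightarrow> (\<forall>t\<ge>0. z t = y t)) \<and>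
           (\<forall>t\<ge>0. ereal t < A_inv a (B_infty b x0) \<longrightarrow> y t = ereal (B_inv b x0 (A_int a t))) \<and>
           (explodes y \<longleftrightarrow> B_infty b x0 < A_infty a) \<and>
           (B_infty b x0 < A_infty a \<longrightarrow> explosion_time y = A_inv a (B_infty b x0))"
proof -
  interpret separable_ivp a b x0
    using assms by unfold_locales
  show ?thesis
    unfolding A_int_eq A_infty_eq B_infty_eq B_inv_eq
  proof (intro exI [of _ extended_sol] conjI allI impI)
    show "is_solution a b x0 extended_sol"
      by (fact is_solution_extended_sol)
    show "z t = extended_sol t" if "is_solution a b x0 z" "0 \<le> t" for z t
      using that by (rule is_solution_unique)
    show "extended_sol t = ereal (B.inverse_primitive (A.primitive t))"
      if "0 \<le> t" "ereal t < A_inv a B.total_integral" for t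
      using in_domain_if_less_blow_up [OF that] by (simp add: extended_sol_def sol_def)
    \<comment> \<open>By its convention \<open>A_inv\<close> is finite exactly at arguments below
      the limit of \<open>A\<close>.\<close>
    show "explodes extended_sol \<longleftrightarrow> B.total_integral < A.total_integral"
      by (auto simp: explodes_def explosion_time_extended_sol A_inv_eq)
    show "explosion_time extended_sol = A_inv a B.total_integral"
      by (fact explosion_time_extended_sol)
  qed
qed

end
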